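(* Let $\alpha=\sum_{i=1}^n a_i\delta_{x_i}$ and $\beta=\sum_{j=1}^m b_j\delta_{y_j}$ be two positive discrete measures on $\mathbb{R}^d$. For $k>0$ denote the mass change of $\alpha$ by $$\alpha_k=\sum_{i=1}^n (k a_i)\,\delta_{x_i}.$$ Then the function $k\mapsto J(k):=J(\alpha_k;\beta)$ is convex with respect to $k$ (on $k>0$), where $J(\cdot\,;\cdot)$ is the objective function defined in the context.
   Context: A positive discrete measure on $\mathbb{R}^d$ ($d\ge 1$) is a measure $\alpha=\sum_{i=1}^n a_i\delta_{x_i}$ with $x_i\in\mathbb{R}^d$ and $a=(a_1,\dots,a_n)\in\mathbb{R}_+^n$ (nonnegative entries), $\|a\|_1=\sum_i a_i>0$. Its normalization is the probability measure $\hat\alpha=\sum_{i=1}^n \hat a_i\delta_{x_i}$ with $\hat a_i=a_i/\|a\|_1$; similarly for $\beta=\sum_{j=1}^m b_j\delta_{y_j}$, $\hat b_j=b_j/\|b\|_1$. For discrete probability measures $\mu=\sum_{i=1}^n p_i\delta_{x_i}$ and $\nu=\sum_{j=1}^m q_j\delta_{y_j}$ on $\mathbb{R}^d$, the squared 2-Wasserstein distance is $$W_2^2(\mu,\nu)=\min\Big\{\sum_{i,j}|x_i-y_j|^2P_{i,j}\ :\ P\in\mathbb{R}_+^{n\times m},\ \sum_j P_{i,j}=p_i\ \forall i,\ \sum_i P_{i,j}=q_j\ \forall j\Big\},$$ with $|\cdot|$ the Euclidean norm. The objective function is $$J(\alpha;\beta)=W_2^2(\hat\alpha,\hat\beta)+\big(\|a\|_1-\|b\|_1\big)^2.$$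 *)

theory Defs
  imports "HOL-Analysis.Analysis"
begin

text \<open>
  \<^term>\<open>Dirac_Sum a x\<close> stands for the discrete measure \<open>\<Sum>i. a\<^sub>i \<delta>\<^bsub>x\<^sub>i\<^esub>\<close> on
  \<open>\<real>\<^sup>d\<close>.  The index sets \<open>{1..n}\<close> and \<open>{1..d}\<close> are finite types.  A measure is given by its
  weights and atoms, and the atoms need not be distinct.
\<close>

datatype ('n::finite, 'd::finite) discrete_measure =
  Dirac_Sum (weights: "real ^ 'n") (atoms: "(real ^ 'd) ^ 'n")

definition l1_norm :: "real ^ 'n::finite \<Rightarrow> real" where
  "l1_norm a = (\<Sum>i\<in>UNIV. \<bar>a $ i\<bar>)"

definition positive_discrete_measure :: "('n::finite, 'd::finite) discrete_measure \<Rightarrow> bool" where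
  "positive_discrete_measure \<alpha> \<longleftrightarrow> (\<forall>i. weights \<alpha> $ i \<ge> 0) \<and> l1_norm (weights \<alpha>) > 0"

definition normalization ::
  "('n::finite, 'd::finite) discrete_measure \<Rightarrow> ('n, 'd) discrete_measure" where
  "normalization \<alpha> = Dirac_Sum (\<chi> i. weights \<alpha> $ i / l1_norm (weights \<alpha>)) (atoms \<alpha>)"

definition mass_change ::
  "real \<Rightarrow> ('n::finite, 'd::finite) discrete_measure \<Rightarrow> ('n, 'd) discrete_measure" where
  "mass_change k \<alpha> = Dirac_Sum (\<chi> i. k * weights \<alpha> $ i) (atoms \<alpha>)"

definition couplings :: "real ^ 'n::finite \<Rightarrow> real ^ 'm::finite \<Rightarrow> (real ^ 'm ^ 'n) set" where
  "couplings p q = {P. (\<forall>i j. P $ i $ j \<ge> 0) \<and>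
     (\<forall>i. (\<Sum>j\<in>UNIV. P $ i $ j) = p $ i) \<and> (\<forall>j. (\<Sum>i\<in>UNIV. P $ i $ j) = q $ j)}"

definition transport_cost ::
  "(real ^ 'd::finite) ^ 'n::finite \<Rightarrow> (real ^ 'd) ^ 'm::finite \<Rightarrow> real ^ 'm ^ 'n \<Rightarrow> real" where
  "transport_cost x y P = (\<Sum>i\<in>UNIV. \<Sum>j\<in>UNIV. (norm (x $ i - y $ j))\<^sup>2 * P $ i $ j)"

text \<open>
  The squared 2-Wasserstein distance, for probability measures.  The infimum is a minimum: see
  \<open>W2_squared_attained\<close> below.
\<close>

definition W2_squared ::
  "('n::finite, 'd::finite) discrete_measure \<Rightarrow> ('m::finite, 'd) discrete_measure \<Rightarrow> real" where
  "W2_squared \<mu> \<nu> =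
     (INF P \<in> couplings (weights \<mu>) (weights \<nu>). transport_cost (atoms \<mu>) (atoms \<nu>) P)"

definition objective ::
  "('n::finite, 'd::finite) discrete_measure \<Rightarrow> ('m::finite, 'd) discrete_measure \<Rightarrow> real" where
  "objective \<alpha> \<beta> = W2_squared (normalization \<alpha>) (normalization \<beta>)
     + (l1_norm (weights \<alpha>) - l1_norm (weights \<beta>))\<^sup>2"

lemma couplings_nonempty:
  fixes p :: "real ^ 'n::finite" and q :: "real ^ 'm::finite"
  assumes "\<And>i. p $ i \<ge> 0" "\<And>j. q $ j \<ge> 0"
    and "(\<Sum>i\<in>UNIV. p $ i) = 1" "(\<Sum>j\<in>UNIV. q $ j) = 1"
  shows "couplings p q \<noteq> {}"
proof -
  have "(\<chi> i j. p $ i * q $ j) \<in> couplings p q"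
    using assms by (simp add: couplings_def flip: sum_distrib_left sum_distrib_right)
  then show ?thesis by blast
qed

lemma compact_couplings:
  fixes p :: "real ^ 'n::finite" and q :: "real ^ 'm::finite"
  shows "compact (couplings p q)"
proof -
  have "closed (couplings p q)"
    unfolding couplings_def
    by (intro closed_Collect_conj closed_Collect_all closed_Collect_le closed_Collect_eq
        continuous_intros)
  moreover have "bounded (couplings p q)"
  proof -
    have "norm P \<le> (\<Sum>i\<in>UNIV. p $ i)" if "P \<in> couplings p q" for P
    proof -
      have "norm P \<le> (\<Sum>i\<in>UNIV. norm (P $ i))"
        unfolding norm_vec_def by (rule L2_set_le_sum) simp
      also have "\<dots> \<le> (\<Sum>i\<in>UNIV. \<Sum>j\<in>UNIV. \<bar>P $ i $ j\<bar>)"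
        by (intro sum_mono norm_le_l1_cart)
      also have "\<dots> = (\<Sum>i\<in>UNIV. p $ i)"
        using that by (simp add: couplings_def)
      finally show ?thesis .
    qed
    then show ?thesis by (auto simp: bounded_iff)
  qed
  ultimately show ?thesis by (simp add: compact_eq_bounded_closed)
qed

lemma W2_squared_attained:
  fixes \<mu> :: "('n::finite, 'd::finite) discrete_measure"
    and \<nu> :: "('m::finite, 'd) discrete_measure"
  assumes "positive_discrete_measure \<mu>" "l1_norm (weights \<mu>) = 1"
    and "positive_discrete_measure \<nu>" "l1_norm (weights \<nu>) = 1"
  shows "\<exists>P \<in> couplings (weights \<mu>) (weights \<nu>).
    W2_squared \<mu> \<nu> = transport_cost (atoms \<mu>) (atoms \<nu>) P \<and>
    (\<forall>Q \<in> couplings (weights \<mu>) (weights \<nu>).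
      transport_cost (atoms \<mu>) (atoms \<nu>) P \<le> transport_cost (atoms \<mu>) (atoms \<nu>) Q)"
proof -
  let ?C = "couplings (weights \<mu>) (weights \<nu>)"
  let ?c = "transport_cost (atoms \<mu>) (atoms \<nu>)"
  have "?C \<noteq> {}"
    using assms by (intro couplings_nonempty) (auto simp: positive_discrete_measure_def l1_norm_def)
  moreover have "continuous_on ?C ?c"
    unfolding transport_cost_def by (intro continuous_intros)
  ultimately obtain P where P: "P \<in> ?C" "\<forall>Q\<in>?C. ?c P \<le> ?c Q"
    using continuous_attains_inf[OF compact_couplings] by metis
  then have "(INF Q\<in>?C. ?c Q) = ?c P"
    by (intro cInf_eq_minimum) auto
  with P show ?thesis
    unfolding W2_squared_def by blast
qed

end

theory Submission
  imports Defs
begin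

text \<open>Scaling all weights by \<open>k > 0\<close> multiplies the total mass by
  \<open>k\<close> and cancels in the normalization. The Wasserstein term is therefore constant in
  \<open>k\<close>, and by \<open>objective_mass_change\<close> the objective is that constant plus
  the square of an affine function of \<open>k\<close>, which is convex by
  \<open>convex_on_affine_power2\<close>.\<close>

lemma l1_norm_mass_change:
  assumes "k > 0"
  shows "l1_norm (weights (mass_change k \<alpha>)) = k * l1_norm (weights \<alpha>)"
  using assms by (simp add: mass_change_def l1_norm_def abs_mult sum_distrib_left)

lemma normalization_mass_change:
  assumes "k > 0"
  shows "normalization (mass_change k \<alpha>) = normalization \<alpha>"
  using assms unfolding normalization_def l1_norm_mass_change[OF assms]
  by (simp add: mass_change_def)

lemma objective_mass_change:
  assumes "k > 0"
  shows "objective (mass_change k \<alpha>) \<beta> = W2_squared (normalization \<alpha>) (normalization \<beta>)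
    + (k * l1_norm (weights \<alpha>) - l1_norm (weights \<beta>))\<^sup>2"
  using assms by (simp add: objective_def l1_norm_mass_change normalization_mass_change)

lemma convex_on_affine_power2:
  fixes a b c :: real
  assumes "convex S"
  shows "convex_on S (\<lambda>k. c + (k * a - b)\<^sup>2)"
proof (rule convex_onI)
  fix t x y :: real
  assume t: "0 < t" "t < 1"
  \<comment> \<open>The convexity gap of a quadratic is explicit: the constant \<open>c\<close> and
    the shift \<open>b\<close> cancel, leaving a nonnegative multiple of a square.\<close>
  have "(1 - t) * (c + (x * a - b)\<^sup>2) + t * (c + (y * a - b)\<^sup>2)
      - (c + (((1 - t) *\<^sub>R x + t *\<^sub>R y) * a - b)\<^sup>2) = t * (1 - t) * (a * (x - y))\<^sup>2"
    by (simp add: power2_eq_square algebra_simps)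
  moreover have "t * (1 - t) * (a * (x - y))\<^sup>2 \<ge> 0"
    using t by simp
  ultimately show "c + (((1 - t) *\<^sub>R x + t *\<^sub>R y) * a - b)\<^sup>2
      \<le> (1 - t) * (c + (x * a - b)\<^sup>2) + t * (c + (y * a - b)\<^sup>2)"
    by linarith
qed (fact assms)

text \<open>Convexity of \<open>S\<close> keeps convex combinations in \<open>S\<close>, so
  agreement on \<open>S\<close> suffices. This matters because the closed form of the objective is
  only established for \<open>k > 0\<close>.\<close>

lemma convex_on_eqI:
  assumes "convex_on S f" "\<And>x. x \<in> S \<Longrightarrow> g x = f x"
  shows "convex_on S g"
  using assms unfolding convex_on_def by (simp add: convexD)

theorem proposition2p7:
  fixes \<alpha> :: "('n::finite, 'd::finite) discrete_measure"
    and \<beta> :: "('m::finite, 'd) discrete_measure"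
  assumes "positive_discrete_measure \<alpha>"
    and "positive_discrete_measure \<beta>"
  shows "convex_on {0<..} (\<lambda>k. objective (mass_change k \<alpha>) \<beta>)"
proof -
  have "convex_on {0<..} (\<lambda>k. W2_squared (normalization \<alpha>) (normalization \<beta>)
      + (k * l1_norm (weights \<alpha>) - l1_norm (weights \<beta>))\<^sup>2)"
    by (intro convex_on_affine_power2 convex_real_interval)
  then show ?thesis
    by (rule convex_on_eqI) (simp add: objective_mass_change)
qed

end
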